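(* Let $G$ be a chordal graph. Then $\mathrm{Mand}(G)$ is a monitoring edge-geodetic set of $G$. (Consequently, $\mathrm{Mand}(G)$ is the unique minimum monitoring edge-geodetic set of $G$.)
   Context: Graphs are finite and simple. For a graph $G=(V,E)$, an edge $e\in E$ and vertices $a,b\in V$, the pair $\{a,b\}$ monitors $e$ if $e$ lies on every shortest path between $a$ and $b$. A set $M\subseteq V$ monitors $e$ if some two vertices of $M$ monitor $e$. A monitoring edge-geodetic set (meg-set) of $G$ is a set $M\subseteq V$ that monitors every edge of $G$. A vertex is mandatory if it belongs to every meg-set of $G$, and $\mathrm{Mand}(G)$ denotes the set of mandatory vertices of $G$. A graph is chordal if it has no induced cycle of length at least $4$. *)

theory Defs
  imports "Graph_Theory.Graph_Theory"
begin

text \<open>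
  Finite simple graphs are modelled by \<^locale>\<open>pair_graph\<close>: finite, loop-free, symmetric arc
  relations. An undirected edge is the two-element set of ends of a pair of mutually inverse arcs.
\<close>

definition undirected :: "('a \<times> 'a) set \<Rightarrow> 'a set set" where
  "undirected A = {{u, v} | u v. (u, v) \<in> A}"

definition edges :: "'a pair_pre_digraph \<Rightarrow> 'a set set" where
  "edges G = undirected (parcs G)"

definition path_edges :: "'a vwalk \<Rightarrow> 'a set set" where
  "path_edges p = undirected (set (vwalk_arcs p))"

definition path_between :: "'a pair_pre_digraph \<Rightarrow> 'a \<Rightarrow> 'a vwalk \<Rightarrow> 'a \<Rightarrow> bool" where
  "path_between G a p b \<longleftrightarrow> vpath p (with_proj G) \<and> hd p = a \<and> last p = b"

definition shortest_path :: "'a pair_pre_digraph \<Rightarrow> 'a \<Rightarrow> 'a vwalk \<Rightarrow> 'a \<Rightarrow> bool" where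
  "shortest_path G a p b \<longleftrightarrow>
     path_between G a p b \<and> (\<forall>q. path_between G a q b \<longrightarrow> vwalk_length p \<le> vwalk_length q)"

text \<open>
  Graphs need not be connected. The first conjunct ensures that vertices in different components,
  which have no shortest path between them, do not vacuously monitor every edge.
\<close>

definition pair_monitors :: "'a pair_pre_digraph \<Rightarrow> 'a \<Rightarrow> 'a \<Rightarrow> 'a set \<Rightarrow> bool" where
  "pair_monitors G a b e \<longleftrightarrow>
     (\<exists>p. shortest_path G a p b) \<and> (\<forall>p. shortest_path G a p b \<longrightarrow> e \<in> path_edges p)"

definition set_monitors :: "'a pair_pre_digraph \<Rightarrow> 'a set \<Rightarrow> 'a set \<Rightarrow> bool" where
  "set_monitors G M e \<longleftrightarrow> (\<exists>a\<in>M. \<exists>b\<in>M. a \<noteq> b \<and> pair_monitors G a b e)"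

definition meg_set :: "'a pair_pre_digraph \<Rightarrow> 'a set \<Rightarrow> bool" where
  "meg_set G M \<longleftrightarrow> M \<subseteq> pverts G \<and> (\<forall>e\<in>edges G. set_monitors G M e)"

definition Mand :: "'a pair_pre_digraph \<Rightarrow> 'a set" where
  "Mand G = {v \<in> pverts G. \<forall>M. meg_set G M \<longrightarrow> v \<in> M}"

text \<open>
  The cycle through the vertices of \<^term>\<open>xs\<close> in this order, with the closing edge from the last
  vertex back to the first; a cycle graph when the list is distinct and has length at least 3.
  The library's \<^const>\<open>pre_digraph.cycle\<close> is not used because in a symmetric digraph it also
  covers an edge traversed back and forth.
\<close>

definition cycle_graph :: "'a list \<Rightarrow> 'a pair_pre_digraph" where
  "cycle_graph xs = \<lparr> pverts = set xs, parcs = symcl (set (vwalk_arcs (xs @ [hd xs]))) \<rparr>"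

definition chordal :: "'a pair_pre_digraph \<Rightarrow> bool" where
  "chordal G \<longleftrightarrow>
     \<not> (\<exists>xs. distinct xs \<and> length xs \<ge> 4 \<and>
            induced_subgraph (with_proj (cycle_graph xs)) (with_proj G))"

end

theory Submission
  imports Defs
begin

text \<open>
  In a chordal graph uniqueness of geodesics is a local property: if each inner vertex of a path
  is the only common neighbour of its two non-adjacent neighbours on the path, then the path is the
  unique geodesic between its ends. A non-mandatory vertex \<open>v\<close> with a neighbour \<open>u\<close> always
  has another neighbour \<open>x\<close> such that \<open>u, v, x\<close> is such a path. Hence a
  longest locally unique path through a given edge ends in two mandatory vertices, and these
  monitor the edge.
\<close>

lemma successively_conv_nth:
  "successively P xs \<longleftrightarrow> (\<forall>i. Suc i < length xs \<longrightarrow> P (xs ! i) (xs ! Suc i))"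
proof (induction P xs rule: successively.induct)
  case (3 P x y xs)
  then show ?case by (auto simp: nth_Cons split: nat.splits)
qed auto

section \<open>Walks and geodesics of a symmetric irreflexive relation\<close>

locale adjacency =
  fixes E :: "'a \<Rightarrow> 'a \<Rightarrow> bool"
  assumes E_sym: "E x y \<Longrightarrow> E y x" and E_irrefl: "\<not> E x x"
begin

definition chordless_cycle :: "'a list \<Rightarrow> bool" where
  "chordless_cycle xs \<longleftrightarrow> distinct xs \<and> length xs \<ge> 4 \<and>
     (\<forall>i j. i < j \<longrightarrow> j < length xs \<longrightarrow>
        (E (xs ! i) (xs ! j) \<longleftrightarrow> j = Suc i \<or> i = 0 \<and> Suc j = length xs))"

text \<open>Competitors are arbitrary walks, so lists can be spliced without checking for
  repetitions; \<open>geodesic_distinct\<close> recovers paths.\<close>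

definition geodesic :: "'a list \<Rightarrow> bool" where
  "geodesic p \<longleftrightarrow> p \<noteq> [] \<and> successively E p \<and>
     (\<forall>q. q \<noteq> [] \<longrightarrow> successively E q \<longrightarrow> hd q = hd p \<longrightarrow> last q = last p \<longrightarrow>
        length p \<le> length q)"

text \<open>The bound \<open>length q \<le> length p\<close>, rather than equality of lengths,
  expresses minimality and uniqueness at once.\<close>

definition unique_geodesic :: "'a list \<Rightarrow> bool" where
  "unique_geodesic p \<longleftrightarrow> p \<noteq> [] \<and> successively E p \<and>
     (\<forall>q. q \<noteq> [] \<longrightarrow> successively E q \<longrightarrow> hd q = hd p \<longrightarrow> last q = last p \<longrightarrow>
        length q \<le> length p \<longrightarrow> q = p)"

text \<open>Equivalently, \<open>[x, y, z]\<close> is a \<open>unique_geodesic\<close>.\<close>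

definition unique_mid :: "'a \<Rightarrow> 'a \<Rightarrow> 'a \<Rightarrow> bool" where
  "unique_mid x y z \<longleftrightarrow> x \<noteq> z \<and> \<not> E x z \<and> E x y \<and> E y z \<and>
     (\<forall>w. E x w \<longrightarrow> E w z \<longrightarrow> w = y)"

text \<open>Only windows of three vertices are constrained, so a single edge qualifies; the extremal
  argument starts from it.\<close>

definition locally_unique :: "'a list \<Rightarrow> bool" where
  "locally_unique p \<longleftrightarrow> successively E p \<and>
     (\<forall>A x y z C. p = A @ [x, y, z] @ C \<longrightarrow> unique_mid x y z)"

text \<open>Connectedness of \<open>S\<close>, phrased with walks to one hub \<open>t\<close> so
  that any two of them can be glued at \<open>t\<close>.\<close>

definition joined_within :: "'a set \<Rightarrow> 'a \<Rightarrow> bool" where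
  "joined_within S t \<longleftrightarrow> (\<forall>s\<in>S. \<exists>p. p \<noteq> [] \<and> hd p = s \<and> last p = t \<and>
     successively E p \<and> set p \<subseteq> S)"

lemma E_commute: "E x y \<longleftrightarrow> E y x"
  using E_sym by blast

lemma successively_rev_iff [simp]: "successively E (rev p) \<longleftrightarrow> successively E p"
  using E_commute by simp

lemma unique_mid_commute: "unique_mid x y z \<longleftrightarrow> unique_mid z y x"
  unfolding unique_mid_def using E_sym by metis

section \<open>Induced detours through a connected set\<close>

text \<open>Among the walks from \<open>a\<close> to \<open>b\<close> that have at least one inner
  vertex and all inner vertices in \<open>S\<close>, take a shortest. A repetition, or a chord other
  than the pair \<open>a\<close>, \<open>b\<close>, would give a shortcut.\<close>

lemma induced_detour:
  assumes ab: "a \<notin> S" "b \<notin> S" "a \<noteq> b" and nbr: "sa \<in> S" "E a sa" "sb \<in> S" "E b sb"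
    and conn: "joined_within S t"
  obtains p where "length p \<ge> 3" "p ! 0 = a" "p ! (length p - 1) = b"
    "\<And>i. 0 < i \<Longrightarrow> Suc i < length p \<Longrightarrow> p ! i \<in> S" "distinct p"
    "\<And>i j. i < j \<Longrightarrow> j < length p \<Longrightarrow>
       E (p ! i) (p ! j) \<longleftrightarrow> j = Suc i \<or> i = 0 \<and> Suc j = length p \<and> E a b"
proof -
  define P where "P q \<longleftrightarrow> length q \<ge> 3 \<and> q ! 0 = a \<and> q ! (length q - 1) = b \<and>
    (\<forall>i. 0 < i \<longrightarrow> Suc i < length q \<longrightarrow> q ! i \<in> S) \<and>
    (\<forall>i. Suc i < length q \<longrightarrow> E (q ! i) (q ! Suc i))" for q
  obtain q r where q: "q \<noteq> []" "hd q = sa" "last q = t" "successively E q" "set q \<subseteq> S"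
    and r: "r \<noteq> []" "hd r = sb" "last r = t" "successively E r" "set r \<subseteq> S"
    using conn nbr unfolding joined_within_def by metis
  obtain r' where r': "rev r = t # r'"
    using r(1,3) by (metis hd_rev list.exhaust_sel rev_is_Nil_conv)
  \<comment> \<open>Here \<open>r'\<close> is the reversed walk from \<open>sb\<close> without its
    first vertex, so that the hub \<open>t\<close> is not doubled.\<close>
  define xs where "xs = q @ r'"
  have xs: "xs \<noteq> []" "set xs \<subseteq> S"
    using q r r' set_rev[of r] by (auto simp: xs_def)
  have l: "last xs = sb"
  proof (cases "r' = []")
    case True
    then show ?thesis using r' r q unfolding xs_def by (metis append_Nil2 last.simps last_rev)
  next
    case False
    then show ?thesis using r' r unfolding xs_def by (metis last.simps last_append last_rev)
  qed
  have "hd xs = sa" using q by (simp add: xs_def)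
  have "successively E (t # r')"
    using r(4) r' by (metis successively_rev_iff)
  then have "successively E xs"
    using q by (auto simp: xs_def successively_append_iff successively_Cons)
  then have "successively E (a # xs @ [b])"
    using xs l nbr E_sym \<open>hd xs = sa\<close> by (auto simp: successively_append_iff successively_Cons)
  moreover have "(a # xs @ [b]) ! i \<in> S" if "0 < i" "Suc i < length (a # xs @ [b])" for i
    using that xs by (cases i) (auto simp: nth_append)
  ultimately have "P (a # xs @ [b])"
    using xs unfolding P_def successively_conv_nth[symmetric]
    by (auto simp: Suc_le_eq simp flip: length_greater_0_conv)
  then obtain p where p: "P p" and least: "\<And>q. P q \<Longrightarrow> length p \<le> length q"
    using ex_has_least_nat[of P _ length] by blast
  have p3: "length p \<ge> 3" and pa: "p ! 0 = a" and pb: "p ! (length p - 1) = b"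
    and pS: "\<And>i. 0 < i \<Longrightarrow> Suc i < length p \<Longrightarrow> p ! i \<in> S"
    and pE: "\<And>i. Suc i < length p \<Longrightarrow> E (p ! i) (p ! Suc i)"
    using p unfolding P_def by blast+
  \<comment> \<open>The exempt chord joins the two ends: cutting along it would leave
    \<open>[a, b]\<close>, which violates the bound 3 in \<open>P\<close>.\<close>
  have cut: False if "E (p ! i) (p ! j)" "Suc i < j" "j < length p" "i \<noteq> 0 \<or> Suc j \<noteq> length p" for i j
  proof -
    let ?q = "take (Suc i) p @ drop j p"
    have n: "?q ! k = (if k \<le> i then p ! k else p ! (k - Suc i + j))" if "k < length ?q" for k
      using that \<open>Suc i < j\<close> \<open>j < length p\<close> by (auto simp: nth_append min_def add.commute)
    have len: "length ?q = Suc i + (length p - j)" using that by simp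
    have "P ?q"
      unfolding P_def
    proof (intro conjI allI impI)
      show "3 \<le> length ?q" using that len by linarith
      have "p \<noteq> []" using that by auto
      then show "?q ! 0 = a" using n[of 0] pa len by simp
      have "length ?q - 1 - Suc i + j = length p - 1" using len that by linarith
      moreover have "length ?q - 1 < length ?q" "\<not> length ?q - 1 \<le> i" using len that by linarith+
      ultimately show "?q ! (length ?q - 1) = b" using n[of "length ?q - 1"] pb by (simp only: if_False)
    next
      fix k assume k: "0 < k" "Suc k < length ?q"
      show "?q ! k \<in> S"
      proof (cases "k \<le> i")
        case True then show ?thesis using n[of k] k pS[of k] that len by simp
      next
        case False then show ?thesis using n[of k] k pS[of "k - Suc i + j"] that len by simp
      qed
    next
      fix k assume k: "Suc k < length ?q"
      show "E (?q ! k) (?q ! Suc k)"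
      proof (cases "k < i")
        case True then show ?thesis using n[of k] n[of "Suc k"] k pE[of k] that len by simp
      next
        case False
        show ?thesis
        proof (cases "k = i")
          case True then show ?thesis using n[of k] n[of "Suc k"] k that len by simp
        next
          case False
          with \<open>\<not> k < i\<close> have "Suc k - Suc i + j = Suc (k - Suc i + j)" by linarith
          then show ?thesis
            using n[of k] n[of "Suc k"] k \<open>\<not> k < i\<close> False pE[of "k - Suc i + j"] that len by simp
        qed
      qed
    qed
    then show False using least len that by fastforce
  qed
  have "p ! i \<noteq> p ! j" if "i < j" "j < length p" for i j
  proof
    assume eq: "p ! i = p ! j"
    have i0: "i \<noteq> 0"
      using that eq pa pb ab pS[of j] by (metis Suc_lessI diff_Suc_1 gr0I less_nat_zero_code)
    have jn: "Suc j < length p"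
      using that eq i0 pa pb ab pS[of i] by (metis Suc_lessI diff_Suc_1 gr0I less_trans_Suc)
    \<comment> \<open>The predecessor of \<open>p ! i\<close> is adjacent to \<open>p ! j\<close> as
      well, and by \<open>jn\<close> this chord is not the exempt one.\<close>
    show False
      using cut[of "i - 1" j] pE[of "i - 1"] eq i0 that jn by simp
  qed
  then have "distinct p" unfolding distinct_conv_nth by (metis nat_neq_iff)
  moreover have "E (p ! i) (p ! j) \<longleftrightarrow> j = Suc i \<or> i = 0 \<and> Suc j = length p \<and> E a b"
    if "i < j" "j < length p" for i j
  proof
    assume e: "E (p ! i) (p ! j)"
    show "j = Suc i \<or> i = 0 \<and> Suc j = length p \<and> E a b"
    proof (cases "j = Suc i")
      case False
      then have "Suc i < j" using that by simp
      then have "i = 0" "Suc j = length p" using cut[OF e] that(2) by blast+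
      then show ?thesis using e pa pb by (metis diff_Suc_1)
    qed simp
  next
    assume "j = Suc i \<or> i = 0 \<and> Suc j = length p \<and> E a b"
    then show "E (p ! i) (p ! j)" using pE that pa pb by (metis diff_Suc_1)
  qed
  ultimately show thesis using that[of p] p3 pa pb pS by blast
qed

text \<open>The edge between \<open>a\<close> and \<open>b\<close> closes an induced detour to a
  chordless cycle unless the detour has just one inner vertex; that vertex is the common
  neighbour.\<close>

lemma common_neighbour_within:
  assumes ch: "\<nexists>xs. chordless_cycle xs"
    and ab: "a \<notin> S" "b \<notin> S" "E a b" and nbr: "sa \<in> S" "E a sa" "sb \<in> S" "E b sb"
    and conn: "joined_within S t"
  shows "\<exists>w\<in>S. E a w \<and> E w b"
proof -
  have "a \<noteq> b" using ab E_irrefl by blast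
  then obtain p where p: "length p \<ge> 3" "p ! 0 = a" "p ! (length p - 1) = b"
    "\<And>i. 0 < i \<Longrightarrow> Suc i < length p \<Longrightarrow> p ! i \<in> S" "distinct p"
    "\<And>i j. i < j \<Longrightarrow> j < length p \<Longrightarrow>
       E (p ! i) (p ! j) \<longleftrightarrow> j = Suc i \<or> i = 0 \<and> Suc j = length p \<and> E a b"
    using induced_detour[OF ab(1,2) _ nbr conn] by blast
  have "length p < 4"
  proof (rule ccontr)
    assume "\<not> length p < 4"
    then have "chordless_cycle p" using p ab(3) unfolding chordless_cycle_def by auto
    then show False using ch by blast
  qed
  then have "length p = 3" using p(1) by linarith
  then show ?thesis
    using p(2,3) p(4)[of 1] p(6)[of 0 1] p(6)[of 1 2] by auto
qed

text \<open>If \<open>a\<close> and \<open>b\<close> were not adjacent, an induced detour between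
  them would have no chord at all. Its ends are its only vertices adjacent to \<open>u\<close>, so
  \<open>u\<close> would close it to a chordless cycle.\<close>

lemma adjacent_if_common_outer_neighbour:
  assumes ch: "\<nexists>xs. chordless_cycle xs"
    and ab: "a \<notin> S" "b \<notin> S" "a \<noteq> b" and nbr: "sa \<in> S" "E a sa" "sb \<in> S" "E b sb"
    and conn: "joined_within S t"
    and u: "E u a" "E u b" "u \<notin> S" "\<And>s. s \<in> S \<Longrightarrow> \<not> E u s"
  shows "E a b"
proof (rule ccontr)
  assume nE: "\<not> E a b"
  obtain p where p: "length p \<ge> 3" "p ! 0 = a" "p ! (length p - 1) = b"
    "\<And>i. 0 < i \<Longrightarrow> Suc i < length p \<Longrightarrow> p ! i \<in> S" "distinct p"
    "\<And>i j. i < j \<Longrightarrow> j < length p \<Longrightarrow>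
       E (p ! i) (p ! j) \<longleftrightarrow> j = Suc i \<or> i = 0 \<and> Suc j = length p \<and> E a b"
    using induced_detour[OF ab nbr conn] by blast
  have pu: "E u (p ! i) \<longleftrightarrow> i = 0 \<or> Suc i = length p" if "i < length p" for i
    using that p(2,3) p(4)[of i] u by (metis Suc_lessI diff_Suc_1 gr0I)
  have "p ! i \<noteq> u" if "i < length p" for i
    using that p(2,3) p(4)[of i] u E_irrefl by (metis Suc_lessI diff_Suc_1 gr0I)
  then have "u \<notin> set p" by (metis in_set_conv_nth)
  moreover have "E ((u # p) ! i) ((u # p) ! j) \<longleftrightarrow> j = Suc i \<or> i = 0 \<and> Suc j = length (u # p)"
    if "i < j" "j < length (u # p)" for i j
  proof -
    obtain j' where j: "j = Suc j'" using \<open>i < j\<close> by (cases j) auto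
    show ?thesis
    proof (cases i)
      case 0
      then show ?thesis using pu[of j'] that j by simp
    next
      case (Suc i')
      then show ?thesis using p(6)[of i' j'] that j nE by simp
    qed
  qed
  ultimately have "chordless_cycle (u # p)"
    using p(1,5) unfolding chordless_cycle_def by simp
  then show False using ch by blast
qed

section \<open>Geodesics and their extension by one vertex\<close>

lemma geodesic_distinct:
  assumes "geodesic p"
  shows "distinct p"
proof (rule ccontr)
  assume "\<not> distinct p"
  then obtain A y B C where p: "p = A @ [y] @ B @ [y] @ C"
    using not_distinct_decomp by blast
  let ?q = "A @ [y] @ C"
  have "successively E p" using assms by (simp add: geodesic_def)
  then have "successively E ?q"
    unfolding p by (auto simp: successively_append_iff successively_Cons)
  moreover have "hd ?q = hd p" "last ?q = last p" "?q \<noteq> []" "length ?q < length p"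
    unfolding p by (auto simp: hd_append last_append)
  ultimately show False using assms unfolding geodesic_def by (metis not_le)
qed

lemma geodesic_rev: "geodesic p \<Longrightarrow> geodesic (rev p)"
  unfolding geodesic_def successively_rev_iff
  by (metis hd_rev last_rev length_rev rev_is_Nil_conv successively_rev_iff)

lemma geodesic_exists:
  assumes "q \<noteq> []" "successively E q"
  obtains p where "geodesic p" "hd p = hd q" "last p = last q" "length p \<le> length q"
proof -
  define P where "P r \<longleftrightarrow> r \<noteq> [] \<and> successively E r \<and> hd r = hd q \<and> last r = last q" for r
  have "P q" using assms by (simp add: P_def)
  then obtain p where "P p" "\<And>r. P r \<Longrightarrow> length p \<le> length r"
    using ex_has_least_nat[of P q length] by blast
  then show thesis using that[of p] \<open>P q\<close> unfolding P_def geodesic_def by auto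
qed

lemma unique_geodesic_geodesic: "unique_geodesic p \<Longrightarrow> geodesic p"
  unfolding unique_geodesic_def geodesic_def by (metis linorder_le_cases order_refl)

lemma unique_geodesic_eq: "unique_geodesic p \<Longrightarrow> geodesic q \<Longrightarrow> hd q = hd p \<Longrightarrow> last q = last p \<Longrightarrow> q = p"
  unfolding unique_geodesic_def geodesic_def by metis

text \<open>If \<open>u = x\<close> or \<open>E u x\<close>, dropping vertices gives a shorter walk.
  Replacing \<open>v\<close> by another common neighbour \<open>w\<close> gives a geodesic with the
  same ends, which must contain \<open>v\<close> by \<open>mid\<close>; since the original list has
  no repetition, \<open>v\<close> can only stand in the place of \<open>w\<close>.\<close>

lemma geodesic_unique_mid:
  assumes g: "geodesic (A @ [u, v, x] @ C)"
    and mid: "\<And>q. geodesic q \<Longrightarrow> hd q = hd (A @ [u, v, x] @ C) \<Longrightarrow>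
      last q = last (A @ [u, v, x] @ C) \<Longrightarrow> v \<in> set q"
  shows "unique_mid u v x"
proof -
  let ?p = "A @ [u, v, x] @ C"
  have s: "successively E ?p" using g by (simp add: geodesic_def)
  have short: "\<not> (q \<noteq> [] \<and> successively E q \<and> hd q = hd ?p \<and> last q = last ?p \<and> length q < length ?p)" for q
    using g unfolding geodesic_def by (metis not_le)
  have "u \<noteq> x"
    using short[of "A @ [x] @ C"] s
    by (cases "A = []") (auto simp: successively_append_iff successively_Cons hd_append last_append)
  moreover have "\<not> E u x"
    using short[of "A @ [u, x] @ C"] s
    by (cases "A = []") (auto simp: successively_append_iff successively_Cons hd_append last_append)
  moreover have "w = v" if "E u w" "E w x" for w
  proof -
    let ?q = "A @ [u, w, x] @ C"
    have "successively E ?q"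
      using s that by (auto simp: successively_append_iff successively_Cons)
    moreover have ends: "hd ?q = hd ?p" "last ?q = last ?p" "length ?q = length ?p"
      by (auto simp: hd_append last_append)
    ultimately have "geodesic ?q" using g unfolding geodesic_def by auto
    then have "v \<in> set ?q" using mid ends by blast
    then show "w = v" using geodesic_distinct[OF g] by auto
  qed
  ultimately show ?thesis
    using s unfolding unique_mid_def by (auto simp: successively_append_iff successively_Cons)
qed

text \<open>
  With \<open>m\<close> the number of vertices of \<^term>\<open>z # r\<close>, detours are taken through the ball \<open>S\<close>
  of vertices joined to the end by a walk on at most \<open>m\<close> vertices. The only neighbour of \<open>y\<close>
  in \<open>S\<close> is \<open>z\<close>, so any common neighbour of \<open>y\<close> and another vertex in \<open>S\<close> must be \<open>z\<close>.
\<close>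

lemma unique_geodesic_Cons:
  assumes ch: "\<nexists>xs. chordless_cycle xs"
    and ug: "unique_geodesic (y # z # r)" and mid: "unique_mid x y z"
  shows "unique_geodesic (x # y # z # r)"
proof -
  define t where "t = last (z # r)"
  define m where "m = length (z # r)"
  define S where "S = {v. \<exists>p. p \<noteq> [] \<and> hd p = v \<and> last p = t \<and> successively E p \<and> length p \<le> m}"
  have conn: "joined_within S t"
    unfolding joined_within_def
  proof
    fix s assume "s \<in> S"
    then obtain p where p: "p \<noteq> []" "hd p = s" "last p = t" "successively E p" "length p \<le> m"
      unfolding S_def by blast
    \<comment> \<open>Every suffix of a walk on at most \<open>m\<close> vertices to
      \<open>t\<close> is again such a walk, so the whole walk stays in the ball.\<close>
    have "v \<in> S" if "v \<in> set p" for v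
    proof -
      obtain A B where AB: "p = A @ v # B" using \<open>v \<in> set p\<close> by (meson split_list)
      have "successively E (v # B)" using p(4) AB by (simp add: successively_append_iff)
      moreover have "last (v # B) = t" "length (v # B) \<le> m" using p AB by auto
      ultimately show "v \<in> S" unfolding S_def by (metis (mono_tags, lifting) list.distinct(1) list.sel(1) mem_Collect_eq)
    qed
    then show "\<exists>p. p \<noteq> [] \<and> hd p = s \<and> last p = t \<and> successively E p \<and> set p \<subseteq> S"
      using p by blast
  qed
  have SI: "hd p \<in> S" if "p \<noteq> []" "last p = t" "successively E p" "length p \<le> m" for p
    using that unfolding S_def by blast
  have yu: "q = y # z # r"
    if "q \<noteq> []" "successively E q" "hd q = y" "last q = t" "length q \<le> Suc m" for q
    using ug that unfolding unique_geodesic_def t_def m_def by auto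
  have m: "E x y" "E y z" "x \<noteq> z" "\<not> E x z" "\<And>w. E x w \<Longrightarrow> E w z \<Longrightarrow> w = y"
    using mid unfolding unique_mid_def by auto
  have s: "successively E (y # z # r)" using ug by (simp add: unique_geodesic_def)
  have zS: "z \<in> S" using SI[of "z # r"] s by (simp add: t_def m_def)
  have yS: "y \<notin> S"
  proof
    assume "y \<in> S"
    then obtain p where p: "p \<noteq> []" "hd p = y" "last p = t" "successively E p" "length p \<le> m"
      unfolding S_def by blast
    then have "p = y # z # r" using yu[of p] by simp
    then show False using p(5) by (simp add: m_def)
  qed
  have yw: "w = z" if "E y w" "w \<in> S" for w
  proof -
    obtain p where p: "p \<noteq> []" "hd p = w" "last p = t" "successively E p" "length p \<le> m"
      using \<open>w \<in> S\<close> unfolding S_def by blast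
    then have "y # p = y # z # r" using yu[of "y # p"] that by (simp add: successively_Cons)
    then show "w = z" using p by simp
  qed
  have xS: "x \<notin> S" using yw[of x] m E_sym by blast
  have "Q = x # y # z # r"
    if Q: "Q \<noteq> []" "successively E Q" "hd Q = x" "last Q = t" "length Q \<le> Suc (Suc m)" for Q
  proof -
    have "Q \<noteq> [x]"
    proof
      assume "Q = [x]"
      then have "hd [x] \<in> S" using Q by (intro SI) (auto simp: m_def)
      then show False using xS by simp
    qed
    then obtain q Q' where Qe: "Q = x # q # Q'"
      using Q by (metis list.collapse)
    have Eq: "E x q" and sQ: "successively E (q # Q')" and lQ: "last (q # Q') = t"
      and len: "length (q # Q') \<le> Suc m"
      using Q unfolding Qe by auto
    \<comment> \<open>If \<open>x\<close> had a neighbour in \<open>S\<close>, the edge between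
      \<open>x\<close> and \<open>y\<close> would have a common neighbour in \<open>S\<close>. It
      could only be \<open>z\<close>, which is not adjacent to \<open>x\<close>.\<close>
    have noS: "\<not> E x w" if w: "w \<in> S" for w
    proof
      assume "E x w"
      then obtain w' where "w' \<in> S" "E x w'" "E w' y"
        using common_neighbour_within[OF ch xS yS m(1) w _ zS m(2) conn] by blast
      then show False using yw m(4) E_sym by blast
    qed
    have qS: "q \<notin> S" using noS Eq by blast
    \<comment> \<open>Otherwise \<open>Q'\<close> starts in \<open>S\<close>, as it has at most
      \<open>m\<close> vertices. So \<open>q\<close> and \<open>y\<close> both have neighbours in
      \<open>S\<close> while \<open>x\<close> sees both but nothing in \<open>S\<close>, which makes
      \<open>q\<close> and \<open>y\<close> adjacent. Their common neighbour in \<open>S\<close> is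
      then \<open>z\<close>, so \<open>q\<close> is a second vertex between \<open>x\<close> and
      \<open>z\<close>.\<close>
    have "q = y"
    proof (rule ccontr)
      assume "q \<noteq> y"
      have "Q' \<noteq> []"
        using SI[of "[q]"] lQ qS by (auto simp: m_def)
      then have h: "hd Q' \<in> S" "E q (hd Q')"
        using SI[of Q'] sQ lQ len by (auto simp: successively_Cons)
      have "E q y"
        using adjacent_if_common_outer_neighbour[OF ch qS yS \<open>q \<noteq> y\<close> h zS m(2) conn Eq m(1) xS]
          noS by blast
      then obtain w where "w \<in> S" "E q w" "E w y"
        using common_neighbour_within[OF ch qS yS _ h zS m(2) conn] by blast
      then have "E q z" using yw E_sym by blast
      then show False using m(5) Eq \<open>q \<noteq> y\<close> by blast
    qed
    then show ?thesis using yu[of "q # Q'"] sQ lQ len Qe by simp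
  qed
  then show ?thesis
    using s m(1) unfolding unique_geodesic_def t_def m_def by auto
qed

section \<open>Locally unique paths as unique geodesics\<close>

lemma locally_unique_ConsD: "locally_unique (x # p) \<Longrightarrow> locally_unique p"
  unfolding locally_unique_def by (metis append_Cons successively_Cons successively.simps(1))

text \<open>The passage from local to global: starting from a single edge,
  \<open>unique_geodesic_Cons\<close> restores one first vertex at a time, and the first window of
  the path supplies its \<open>unique_mid\<close> hypothesis.\<close>

lemma locally_unique_imp_unique_geodesic:
  assumes ch: "\<nexists>xs. chordless_cycle xs"
  shows "locally_unique p \<Longrightarrow> length p \<ge> 2 \<Longrightarrow> unique_geodesic p"
proof (induction p)
  case (Cons x p)
  then obtain y r where p: "p = y # r" by (cases p) auto
  show ?case
  proof (cases r)
    case Nil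
    have "E x y" using Cons.prems p Nil by (simp add: locally_unique_def)
    moreover have "q = [x, y]"
      if "q \<noteq> []" "hd q = x" "last q = y" "length q \<le> 2" for q
      using that \<open>E x y\<close> E_irrefl
      by (cases q rule: vwalk_arcs.cases) auto
    ultimately show ?thesis using p Nil unfolding unique_geodesic_def by simp
  next
    case (Cons z r')
    have "unique_geodesic p"
      using Cons.IH Cons.prems locally_unique_ConsD p Cons by fastforce
    moreover have "unique_mid x y z"
      using Cons.prems(1) p Cons unfolding locally_unique_def by (metis append_Cons append_Nil)
    ultimately show ?thesis using unique_geodesic_Cons[OF ch] p Cons by simp
  qed
qed simp

lemma locally_unique_rev: "locally_unique p \<Longrightarrow> locally_unique (rev p)"
proof -
  assume p: "locally_unique p"
  have "unique_mid x y z" if "rev p = A @ [x, y, z] @ C" for A x y z C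
  proof -
    have "p = rev C @ [z, y, x] @ rev A" using that by (metis append.assoc append_Cons append_Nil rev.simps(2) rev_append rev_rev_ident rev.simps(1))
    then show ?thesis using p unique_mid_commute unfolding locally_unique_def by blast
  qed
  then show ?thesis
    using p unfolding locally_unique_def successively_rev_iff by blast
qed

lemma locally_unique_Cons:
  assumes "locally_unique (v # u # r)" "unique_mid x v u"
  shows "locally_unique (x # v # u # r)"
  unfolding locally_unique_def
proof (intro conjI allI impI)
  show "successively E (x # v # u # r)"
  proof -
    have "successively E (v # u # r)" using assms(1) unfolding locally_unique_def by blast
    moreover have "E x v" using assms(2) unfolding unique_mid_def by blast
    ultimately show ?thesis by simp
  qed
  fix A a b c C assume e: "x # v # u # r = A @ [a, b, c] @ C"
  show "unique_mid a b c"
  proof (cases A)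
    case Nil then show ?thesis using e assms(2) by simp
  next
    case (Cons x' A')
    then have "v # u # r = A' @ [a, b, c] @ C" using e by simp
    then show ?thesis using assms(1) unfolding locally_unique_def by blast
  qed
qed

end

section \<open>Path edges as consecutive pairs of a vertex list\<close>

lemma mem_vwalk_arcs: "(u, v) \<in> set (vwalk_arcs p) \<longleftrightarrow> (\<exists>A C. p = A @ [u, v] @ C)"
proof (induction p rule: vwalk_arcs.induct)
  case (3 x y xs)
  have "(\<exists>A C. x # y # xs = A @ [u, v] @ C) \<longleftrightarrow> (x = u \<and> y = v) \<or> (\<exists>A C. y # xs = A @ [u, v] @ C)"
    by (metis (no_types, lifting) append_Cons append_Nil list.exhaust list.inject)
  then show ?case using 3 by auto
qed (auto simp: append_eq_Cons_conv Cons_eq_append_conv)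

lemma mem_path_edges: "{u, v} \<in> path_edges p \<longleftrightarrow>
    (\<exists>A C. p = A @ [u, v] @ C) \<or> (\<exists>A C. p = A @ [v, u] @ C)"
  unfolding path_edges_def undirected_def mem_vwalk_arcs[symmetric]
  by (auto simp: doubleton_eq_iff)

lemma path_edges_rev [simp]: "path_edges (rev p) = path_edges p"
proof -
  have "{u, v} \<in> path_edges (rev p) \<Longrightarrow> {u, v} \<in> path_edges p" for u v and p :: "'a list"
    unfolding mem_path_edges
    by (metis append.assoc append_Cons append_Nil rev.simps rev_append rev_rev_ident)
  then have "path_edges (rev p) \<subseteq> path_edges p" for p :: "'a list"
    unfolding path_edges_def undirected_def by blast
  then show ?thesis by (metis rev_rev_ident subset_antisym)
qed

lemma mem_vwalk_arcs_nth: "(u, v) \<in> set (vwalk_arcs p) \<longleftrightarrow>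
    (\<exists>i. Suc i < length p \<and> u = p ! i \<and> v = p ! Suc i)"
  unfolding mem_vwalk_arcs
proof
  assume "\<exists>A C. p = A @ [u, v] @ C"
  then obtain A C where "p = A @ [u, v] @ C" by blast
  then show "\<exists>i. Suc i < length p \<and> u = p ! i \<and> v = p ! Suc i"
    by (intro exI[of _ "length A"]) (auto simp: nth_append)
next
  assume "\<exists>i. Suc i < length p \<and> u = p ! i \<and> v = p ! Suc i"
  then obtain i where i: "Suc i < length p" "u = p ! i" "v = p ! Suc i" by blast
  then have "p = take i p @ [u, v] @ drop (Suc (Suc i)) p"
    by (simp add: Cons_nth_drop_Suc)
  then show "\<exists>A C. p = A @ [u, v] @ C" by blast
qed

section \<open>Cycles of the graph in terms of list positions\<close>

context pair_graph
begin

interpretation adjacency "\<lambda>x y. (x, y) \<in> parcs G"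
proof
  show "(y, x) \<in> parcs G" if "(x, y) \<in> parcs G" for x y
    using pair_sym_arcs that by (auto simp: symmetric_def dest: symD)
  show "(x, x) \<notin> parcs G" for x
    using pair_no_loops by fastforce
qed

text \<open>Rewrites the closing arc, which runs from the last position to the first, as the
  increasing pair of positions used in \<open>chordless_cycle\<close>.\<close>

lemma parcs_cycle_graph:
  assumes "length xs \<ge> 2"
  shows "(u, v) \<in> parcs (cycle_graph xs) \<longleftrightarrow>
    (\<exists>i j. i < j \<and> j < length xs \<and> (j = Suc i \<or> i = 0 \<and> Suc j = length xs) \<and>
      (u = xs ! i \<and> v = xs ! j \<or> v = xs ! i \<and> u = xs ! j))"
proof -
  have arc: "(u, v) \<in> set (vwalk_arcs (xs @ [hd xs])) \<longleftrightarrow>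
     (\<exists>i. Suc i < length xs \<and> u = xs ! i \<and> v = xs ! Suc i) \<or>
     u = xs ! (length xs - 1) \<and> v = xs ! 0" for u v
  proof -
    have "xs \<noteq> []" using assms by auto
    then have h: "hd xs = xs ! 0" by (simp add: hd_conv_nth)
    \<comment> \<open>The appended \<open>hd xs\<close> contributes exactly one further arc, which
      starts at position \<open>length xs - 1\<close>.\<close>
    have "(\<exists>i. Suc i < length (xs @ [hd xs]) \<and> P i) \<longleftrightarrow>
       (\<exists>i. Suc i < length xs \<and> P i) \<or> P (length xs - 1)" for P
    proof -
      have "Suc i < length (xs @ [hd xs]) \<longleftrightarrow> Suc i < length xs \<or> i = length xs - 1" for i
        using assms by auto
      then show ?thesis by blast
    qed
    then show ?thesis
      unfolding mem_vwalk_arcs_nth using assms h by (auto simp: nth_append)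
  qed
  show ?thesis (is "_ \<longleftrightarrow> ?R")
  proof -
    have "(u, v) \<in> parcs (cycle_graph xs) \<longleftrightarrow>
        (u, v) \<in> set (vwalk_arcs (xs @ [hd xs])) \<or> (v, u) \<in> set (vwalk_arcs (xs @ [hd xs]))"
      by (auto simp: cycle_graph_def symcl_def)
    also have "\<dots> \<longleftrightarrow> ?R"
      unfolding arc
    proof
      assume "((\<exists>i. Suc i < length xs \<and> u = xs ! i \<and> v = xs ! Suc i) \<or> u = xs ! (length xs - 1) \<and> v = xs ! 0) \<or>
        ((\<exists>i. Suc i < length xs \<and> v = xs ! i \<and> u = xs ! Suc i) \<or> v = xs ! (length xs - 1) \<and> u = xs ! 0)"
      moreover have "0 < length xs - 1" "length xs - 1 < length xs" "Suc (length xs - 1) = length xs"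
        using assms by auto
      ultimately show ?R by (metis lessI)
    next
      assume ?R
      then obtain i j where ij: "i < j" "j < length xs" "j = Suc i \<or> i = 0 \<and> Suc j = length xs"
        "u = xs ! i \<and> v = xs ! j \<or> v = xs ! i \<and> u = xs ! j" by blast
      then have "j = Suc i \<or> i = 0 \<and> j = length xs - 1" by auto
      then show "((\<exists>i. Suc i < length xs \<and> u = xs ! i \<and> v = xs ! Suc i) \<or> u = xs ! (length xs - 1) \<and> v = xs ! 0) \<or>
        ((\<exists>i. Suc i < length xs \<and> v = xs ! i \<and> u = xs ! Suc i) \<or> v = xs ! (length xs - 1) \<and> u = xs ! 0)"
        using ij by blast
    qed
    finally show ?thesis .
  qed
qed

lemma no_chordless_cycle:
  assumes "chordal G"
  shows "\<nexists>xs. chordless_cycle xs"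
proof
  assume "\<exists>xs. chordless_cycle xs"
  then obtain xs where d: "distinct xs" and l: "length xs \<ge> 4"
    and e: "\<And>i j. i < j \<Longrightarrow> j < length xs \<Longrightarrow>
      (xs ! i, xs ! j) \<in> parcs G \<longleftrightarrow> j = Suc i \<or> i = 0 \<and> Suc j = length xs"
    unfolding chordless_cycle_def by blast
  have arcs: "parcs (cycle_graph xs) = {a \<in> parcs G. fst a \<in> set xs \<and> snd a \<in> set xs}"
  proof (intro set_eqI, clarify)
    fix u v
    have "(u, v) \<in> parcs (cycle_graph xs) \<longleftrightarrow>
      (\<exists>i j. i < j \<and> j < length xs \<and> (xs ! i, xs ! j) \<in> parcs G \<and>
        (u = xs ! i \<and> v = xs ! j \<or> v = xs ! i \<and> u = xs ! j))"
      using parcs_cycle_graph[of xs u v] l e by auto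
    also have "\<dots> \<longleftrightarrow> (u, v) \<in> parcs G \<and> u \<in> set xs \<and> v \<in> set xs"
    proof
      assume "(u, v) \<in> parcs G \<and> u \<in> set xs \<and> v \<in> set xs"
      moreover from this obtain i j where "i < length xs" "j < length xs" "u = xs ! i" "v = xs ! j"
        by (metis in_set_conv_nth)
      ultimately show "\<exists>i j. i < j \<and> j < length xs \<and> (xs ! i, xs ! j) \<in> parcs G \<and>
        (u = xs ! i \<and> v = xs ! j \<or> v = xs ! i \<and> u = xs ! j)"
        using E_sym E_irrefl by (metis nat_neq_iff)
    qed (auto intro: E_sym)
    finally show "(u, v) \<in> parcs (cycle_graph xs) \<longleftrightarrow>
        (u, v) \<in> {a \<in> parcs G. fst a \<in> set xs \<and> snd a \<in> set xs}" by simp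
  qed
  \<comment> \<open>As \<open>chordless_cycle\<close> does not mention \<open>pverts G\<close>, each
    vertex is placed there by an incident arc: the one to its successor or, for the last vertex, the
    closing one.\<close>
  have "set xs \<subseteq> pverts G"
  proof
    fix x assume "x \<in> set xs"
    then obtain i where i: "i < length xs" "x = xs ! i" by (metis in_set_conv_nth)
    show "x \<in> pverts G"
    proof (cases "Suc i < length xs")
      case True then show ?thesis using e[of i "Suc i"] i in_arcsD1 by auto
    next
      case False
      then have "0 < i" "Suc i = length xs" using i l by auto
      then show ?thesis using e[of 0 i] i in_arcsD2 by auto
    qed
  qed
  moreover have "pverts (cycle_graph xs) = set xs" by (simp add: cycle_graph_def)
  moreover have "wf_digraph (with_proj (cycle_graph xs))"
    using arcs by (auto simp: wf_digraph_wp_iff cycle_graph_def intro!: pair_wf_digraph.intro)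
  ultimately have "induced_subgraph (with_proj (cycle_graph xs)) (with_proj G)"
    using arcs wf_digraph_axioms unfolding induced_subgraph_def subgraph_def by auto
  then show False using assms d l unfolding chordal_def by blast
qed

section \<open>Shortest paths of the graph as geodesics\<close>

lemma successively_arcs_iff:
  "successively (\<lambda>x y. (x, y) \<in> parcs G) p \<longleftrightarrow> set (vwalk_arcs p) \<subseteq> parcs G"
  by (induction p rule: vwalk_arcs.induct) auto

text \<open>Distinct ends exclude the one-vertex walk, whose vertex could lie outside
  \<open>pverts G\<close>; in a longer walk every vertex is an end of an arc.\<close>

lemma walk_verts:
  assumes "successively (\<lambda>x y. (x, y) \<in> parcs G) p" "hd p \<noteq> last p"
  shows "set p \<subseteq> pverts G"
proof -
  have "set (y # r) \<subseteq> pverts G" if "successively (\<lambda>x y. (x, y) \<in> parcs G) (x # y # r)" for x y r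
    using that by (induction r arbitrary: x y) (auto dest: in_arcsD1 in_arcsD2)
  then show ?thesis
    using assms by (cases p rule: vwalk_arcs.cases) (auto dest: in_arcsD1 in_arcsD2)
qed

lemma path_between_iff:
  assumes "a \<noteq> b"
  shows "path_between G a p b \<longleftrightarrow> p \<noteq> [] \<and> successively (\<lambda>x y. (x, y) \<in> parcs G) p \<and>
    distinct p \<and> hd p = a \<and> last p = b"
  using walk_verts[of p] assms
  unfolding path_between_def vpath_def vwalk_def successively_arcs_iff by auto

text \<open>Minimality over paths and over walks agree, because every walk is at least as long as
  some geodesic with its ends, and geodesics repeat no vertex.\<close>

lemma shortest_path_iff:
  assumes "a \<noteq> b"
  shows "shortest_path G a p b \<longleftrightarrow> geodesic p \<and> hd p = a \<and> last p = b"
proof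
  assume s: "shortest_path G a p b"
  then have p: "p \<noteq> []" "successively (\<lambda>x y. (x, y) \<in> parcs G) p" "hd p = a" "last p = b"
    unfolding shortest_path_def path_between_iff[OF assms] by auto
  have "length p \<le> length q"
    if q: "q \<noteq> []" "successively (\<lambda>x y. (x, y) \<in> parcs G) q" "hd q = hd p" "last q = last p" for q
  proof -
    obtain r where r: "geodesic r" "hd r = hd q" "last r = last q" "length r \<le> length q"
      using geodesic_exists[OF q(1,2)] by blast
    then have "path_between G a r b"
      using that p geodesic_distinct[OF r(1)] unfolding path_between_iff[OF assms] geodesic_def by auto
    \<comment> \<open>\<open>vwalk_length\<close> counts arcs; as both lists are nonempty, the
      truncated subtraction can be undone.\<close>
    then have "length p - 1 \<le> length r - 1" using s unfolding shortest_path_def by auto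
    moreover have "r \<noteq> []" using r unfolding geodesic_def by blast
    ultimately have "length p \<le> length r" using p(1) by (cases p; cases r) auto
    then show ?thesis using r(4) by linarith
  qed
  then show "geodesic p \<and> hd p = a \<and> last p = b" using p unfolding geodesic_def by blast
next
  assume g: "geodesic p \<and> hd p = a \<and> last p = b"
  then show "shortest_path G a p b"
    using geodesic_distinct[of p]
    unfolding shortest_path_def path_between_iff[OF assms] geodesic_def by (auto intro: diff_le_mono)
qed

lemma pair_monitors_commute:
  assumes "a \<noteq> b" "pair_monitors G a b e"
  shows "pair_monitors G b a e"
proof -
  have sp: "shortest_path G b p a \<Longrightarrow> shortest_path G a (rev p) b"
    "shortest_path G a p b \<Longrightarrow> shortest_path G b (rev p) a" for p
    using assms(1) geodesic_rev by (auto simp: shortest_path_iff hd_rev last_rev)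
  show ?thesis
    unfolding pair_monitors_def
  proof (intro conjI allI impI)
    show "\<exists>p. shortest_path G b p a"
      using assms(2) sp(2) unfolding pair_monitors_def by blast
    fix p assume "shortest_path G b p a"
    then have "e \<in> path_edges (rev p)"
      using assms(2) sp(1) unfolding pair_monitors_def by blast
    then show "e \<in> path_edges p" by simp
  qed
qed

section \<open>Mandatory vertices\<close>

text \<open>Some meg-set avoids \<open>v\<close>, and two of its vertices monitor the edge between
  \<open>u\<close> and \<open>v\<close>. All geodesics between these two pass through
  \<open>v\<close> as an inner vertex, so \<open>geodesic_unique_mid\<close> applies;
  \<open>x\<close> is the vertex on the other side of \<open>v\<close> from
  \<open>u\<close>.\<close>

lemma non_mandatory_unique_mid:
  assumes v: "v \<notin> Mand G" and uv: "(u, v) \<in> parcs G"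
  obtains x where "unique_mid u v x"
proof -
  note obt = that
  have vG: "v \<in> pverts G" using uv in_arcsD2 by blast
  then obtain M where M: "meg_set G M" "v \<notin> M" using v unfolding Mand_def by blast
  have "{u, v} \<in> edges G" using uv unfolding edges_def undirected_def by blast
  then obtain a b where ab: "a \<in> M" "b \<in> M" "a \<noteq> b" "pair_monitors G a b {u, v}"
    using M unfolding meg_set_def set_monitors_def by blast
  \<comment> \<open>Stated for arbitrary \<open>a\<close>, \<open>b\<close> and \<open>p\<close>, so
    that a geodesic traversing the edge from \<open>v\<close> to \<open>u\<close> can be handled
    through its reversal.\<close>
  have main: thesis
    if ab: "b \<noteq> v" "a \<noteq> b" "pair_monitors G a b {u, v}"
      and p: "geodesic p" "hd p = a" "last p = b" "p = A @ [u, v] @ C" for a b p A C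
  proof -
    have "C \<noteq> []" using ab p by auto
    then obtain x C' where "C = x # C'" by (cases C) auto
    then have pe: "p = A @ [u, v, x] @ C'" using p by simp
    have "v \<in> set q" if q: "geodesic q" "hd q = hd p" "last q = last p" for q
    proof -
      have "{u, v} \<in> path_edges q"
        using ab(3) q p(2,3) shortest_path_iff[OF ab(2)] unfolding pair_monitors_def by simp
      then show ?thesis unfolding mem_path_edges by auto
    qed
    then have "unique_mid u v x" using p(1) unfolding pe by (intro geodesic_unique_mid)
    then show thesis by (rule obt)
  qed
  obtain p where p: "shortest_path G a p b" "{u, v} \<in> path_edges p"
    using ab unfolding pair_monitors_def by blast
  have g: "geodesic p" "hd p = a" "last p = b"
    using p(1) unfolding shortest_path_iff[OF ab(3)] by auto
  consider A C where "p = A @ [u, v] @ C" | A C where "p = A @ [v, u] @ C"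
    using p(2) unfolding mem_path_edges by blast
  then show thesis
  proof cases
    case 1
    have "b \<noteq> v" using ab(2) M(2) by blast
    then show thesis using main ab(3,4) g 1 by blast
  next
    case (2 A C)
    then have "rev p = rev C @ [u, v] @ rev A" by simp
    moreover have "hd (rev p) = b" "last (rev p) = a"
      using g by (auto simp: hd_rev last_rev)
    ultimately show thesis
      using main[of a b "rev p"] ab M(2) geodesic_rev[OF g(1)] pair_monitors_commute[OF ab(3,4)] by metis
  qed
qed

lemma meg_set_Mand:
  assumes "chordal G"
  shows "meg_set G (Mand G)"
  unfolding meg_set_def
proof (intro conjI ballI)
  show "Mand G \<subseteq> pverts G" unfolding Mand_def by blast
  fix e assume "e \<in> edges G"
  then obtain u v where uv: "(u, v) \<in> parcs G" "e = {u, v}"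
    unfolding edges_def undirected_def by blast
  define T where "T p \<longleftrightarrow> locally_unique p \<and> e \<in> path_edges p" for p
  have ug: "unique_geodesic p" and len: "length p \<ge> 2" if "T p" for p
  proof -
    show len: "length p \<ge> 2"
      using that uv(2) unfolding T_def by (auto simp: mem_path_edges)
    show "unique_geodesic p"
      using locally_unique_imp_unique_geodesic[OF no_chordless_cycle[OF assms] _ len] that
      unfolding T_def by blast
  qed
  have ends: "hd p \<noteq> last p" if "T p" for p
    using geodesic_distinct[OF unique_geodesic_geodesic[OF ug[OF that]]] len[OF that]
    by (cases p rule: vwalk_arcs.cases) auto
  have "T [u, v]"
    using uv unfolding T_def locally_unique_def by (auto simp: mem_path_edges Cons_eq_append_conv append_eq_Cons_conv)
  \<comment> \<open>A unique geodesic is a distinct list of vertices, so finiteness of the graph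
    yields a longest path satisfying \<open>T\<close>.\<close>
  moreover have "length p < Suc (card (pverts G))" if "T p" for p
  proof -
    have "set p \<subseteq> pverts G"
      using walk_verts ends that unfolding T_def locally_unique_def by blast
    moreover have "distinct p" using geodesic_distinct unique_geodesic_geodesic ug that by blast
    ultimately show ?thesis by (metis card_mono distinct_card le_imp_less_Suc pair_finite_verts)
  qed
  ultimately obtain p where p: "T p" and greatest: "\<And>q. T q \<Longrightarrow> length q \<le> length p"
    using ex_has_greatest_nat[of T "[u, v]" length "Suc (card (pverts G))"] by blast
  \<comment> \<open>Proved for every path of maximal length, in order to cover \<open>rev p\<close>
    and thereby the other end of \<open>p\<close>.\<close>
  have mand: "hd q \<in> Mand G" if q: "T q" "length q = length p" for q
  proof (rule ccontr)
    assume n: "hd q \<notin> Mand G"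
    obtain y z r where qe: "q = y # z # r"
      using len[OF q(1)] by (cases q rule: vwalk_arcs.cases) auto
    have "(z, y) \<in> parcs G" using q(1) E_sym unfolding T_def locally_unique_def qe by simp
    then obtain x where "unique_mid z y x" using non_mandatory_unique_mid n qe by auto
    \<comment> \<open>Only the new first window needs checking; that \<open>x\<close> does not
      already occur in \<open>q\<close> need not be shown.\<close>
    then have "locally_unique (x # q)"
      using locally_unique_Cons q(1) unique_mid_commute unfolding qe T_def by blast
    moreover have "e \<in> path_edges (x # q)"
      using q(1) unfolding T_def qe path_edges_def undirected_def by auto
    ultimately show False using greatest[of "x # q"] q(2) unfolding T_def by simp
  qed
  have "hd p \<in> Mand G" using mand p by blast
  moreover have "last p \<in> Mand G"
    using mand[of "rev p"] p locally_unique_rev unfolding T_def by (simp add: hd_rev)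
  moreover have "pair_monitors G (hd p) (last p) e"
    unfolding pair_monitors_def shortest_path_iff[OF ends[OF p]]
  proof (intro conjI allI impI)
    show "\<exists>q. geodesic q \<and> hd q = hd p \<and> last q = last p"
      using unique_geodesic_geodesic ug p by blast
    fix q assume "geodesic q \<and> hd q = hd p \<and> last q = last p"
    then have "q = p" using unique_geodesic_eq ug p by blast
    then show "e \<in> path_edges q" using p unfolding T_def by blast
  qed
  ultimately show "set_monitors G (Mand G) e"
    using ends[OF p] unfolding set_monitors_def by blast
qed

end

theorem theorem1:
  fixes G :: "'a pair_pre_digraph"
  assumes "pair_graph G" and "chordal G"
  shows "meg_set G (Mand G) \<and> (\<forall>M. is_arg_min card (meg_set G) M \<longleftrightarrow> M = Mand G)"
proof -
  interpret pair_graph G by fact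
  have meg: "meg_set G (Mand G)" using meg_set_Mand assms(2) by blast
  have sub: "Mand G \<subseteq> M" "finite M" if "meg_set G M" for M
    using that finite_subset[OF _ pair_finite_verts] unfolding Mand_def meg_set_def by auto
  \<comment> \<open>A meg-set of least size contains \<open>Mand G\<close> and is no larger, so by
    finiteness the two coincide.\<close>
  have "is_arg_min card (meg_set G) M \<longleftrightarrow> M = Mand G" for M
    using meg sub unfolding is_arg_min_def by (metis card_mono card_seteq not_le)
  then show ?thesis using meg by blast
qed

end
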